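(* Let $a\in\mathbb{R}$, $l>0$, and let $\{f_n(t)\}_{n=0}^\infty$, $t\in[a,a+2l]$, be an $L_2$-orthogonal system on $[a,a+2l]$. Let $k\in\mathbb{N}$ ($k\ge 1$) be fixed. Then for all sufficiently large $T>0$ the following holds: for each $p=1,2,\dots,k$, the functions $$ f_n^p(t)=f_n\!\left(\varphi_1^p\!\left(\frac{(T+2l)_p-T_p}{2l}(t-a)+T_p\right)-T+a\right)\prod_{r=0}^{p-1}\left|\tilde Z\!\left(\varphi_1^r\!\left(\frac{(T+2l)_p-T_p}{2l}(t-a)+T_p\right)\right)\right|,\qquad t\in[a,a+2l],\ n=0,1,2,\dots, $$ form an $L_2$-orthogonal system $\{f_n^p(t)\}_{n=0}^\infty$ on $[a,a+2l]$. Here $\varphi_1$ is the Jacob's ladder, $\varphi_1^r$ its iterates, $\tilde Z$ the associated function with $\tilde Z^2=\varphi_1'$, and $T_p=\varphi_1^{-p}(T)$, $(T+2l)_p=\varphi_1^{-p}(T+2l)$ are the $p$-th reverse iterates.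
   Context: $L_2$-orthogonal system: a sequence of real-valued functions $f_n\in L_2([a,a+2l])$ with $\int_a^{a+2l}f_m(t)f_n(t)\,dt=0$ for all $m\neq n$. Hardy's function: $Z(t)=e^{i\vartheta(t)}\zeta\left(\frac12+it\right)$ with $\vartheta(t)=-\frac t2\ln\pi+\operatorname{Im}\ln\Gamma\left(\frac14+i\frac t2\right)$, where $\zeta$ is the Riemann zeta-function; thus $Z^2(t)=|\zeta(\frac12+it)|^2$. Jacob's ladder: fix $\mu(y)=\alpha\, y\ln y$ with some constant $\alpha\in[7,8]$. For all sufficiently large $T$, say $T\ge T_0$, let $\varphi(T)$ be the (known to be unique) solution $x(T)=\varphi(T)$, with $\varphi(T)\to\infty$ as $T\to\infty$, of the integral equation $$\int_0^{\mu[x(T)]}Z^2(t)e^{-\frac{2}{x(T)}t}\,dt=\int_0^TZ^2(t)\,dt .$$ The Jacob's ladder is $\varphi_1(T)=\frac12\varphi(T)$. It is a smooth, increasing function on $[T_0,+\infty)$, tending to $+\infty$. Function $\tilde Z$: it is defined (up to sign, which is irrelevant here as only $|\tilde Z|$ is used) by $$\tilde Z^2(t)=\frac{d\varphi_1(t)}{dt}=\frac{1}{\omega(t)}\left|\zeta\left(\tfrac12+it\right)\right|^2,\qquad \omega(t)=\left\{1+\mathcal{O}\left(\frac{\ln\ln t}{\ln t}\right)\right\}\ln t,\quad t\to\infty ,$$ so $|\tilde Z(t)|=\sqrt{\varphi_1'(t)}$; the second equality is a known property of $\varphi_1$. Direct iterates: $\varphi_1^0(t)=t$, $\varphi_1^1(t)=\varphi_1(t)$,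 $\varphi_1^r(t)=\varphi_1(\varphi_1^{r-1}(t))$. Reverse iterates: for large $S$, put $S_0=S$ and define $S_p$ by $\varphi_1(S_p)=S_{p-1}$, i.e. $S_p=\varphi_1^{-p}(S)$ is the $p$-fold application of the inverse function $\varphi_1^{-1}$ to $S$. In particular $T_p=\varphi_1^{-p}(T)$ and $(T+2l)_p=\varphi_1^{-p}(T+2l)$. *)

theory Defs
  imports "HOL-Complex_Analysis.Complex_Analysis"
begin

(* The Riemann zeta function as the analytic continuation of its Dirichlet series, here only to
   the region Re s > 0, s \<noteq> 1: this region is connected, so the continuation is unique and
   is the restriction of the continuation to the whole punctured plane.  Outside the region the
   value is unspecified; only the critical line Re s = 1/2 is used below. *)
definition zeta :: "complex \<Rightarrow> complex" where
  "zeta = (SOME f. f holomorphic_on ({s. Re s > 0} - {1}) \<and>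
                   (\<forall>s. Re s > 1 \<longrightarrow> (\<lambda>n. 1 / of_nat (Suc n) powr s) sums f s))"

(* The library's ln_Gamma on the complex numbers is the continuous branch of log Gamma (real on
   the positive axis), not the principal logarithm of Gamma. *)
definition hardy_theta :: "real \<Rightarrow> real" where
  "hardy_theta t = - (t / 2) * ln pi + Im (ln_Gamma (1/4 + \<i> * of_real (t / 2)))"

(* Hardy's function takes real values, so its square is the square of its modulus; the type is
   complex only because realness is a consequence of the functional equation of zeta.  Below,
   Z^2(t) is written (cmod (hardy_Z t))^2, which is |zeta(1/2 + it)|^2. *)
definition hardy_Z :: "real \<Rightarrow> complex" where
  "hardy_Z t = exp (\<i> * of_real (hardy_theta t)) * zeta (1/2 + \<i> * of_real t)"

definition ladder_mu :: "real \<Rightarrow> real \<Rightarrow> real" where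
  "ladder_mu \<alpha> y = \<alpha> * y * ln y"

(* Positivity of phi keeps the argument of the logarithm in its mathematical domain (the
   library's ln is total). As T > 0, the right-hand side is then positive, which forces
   ladder_mu \<alpha> (\<phi> T) > 0, so both integrals are over genuine intervals. *)
definition ladder_solution :: "real \<Rightarrow> real \<Rightarrow> (real \<Rightarrow> real) \<Rightarrow> bool" where
  "ladder_solution \<alpha> T0 \<phi> \<longleftrightarrow>
     T0 > 0 \<and> filterlim \<phi> at_top at_top \<and>
     (\<forall>T\<ge>T0. \<phi> T > 0 \<and>
        integral {0..ladder_mu \<alpha> (\<phi> T)} (\<lambda>t. (cmod (hardy_Z t))\<^sup>2 * exp (- (2 / \<phi> T) * t)) =
        integral {0..T} (\<lambda>t. (cmod (hardy_Z t))\<^sup>2))"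

(* \<phi>1 is a Jacob's ladder on [T0, \<infinity>); its values below T0 are irrelevant.
   Smoothness and monotonicity are not required: they follow from the integral equation. *)
definition jacobs_ladder :: "real \<Rightarrow> real \<Rightarrow> (real \<Rightarrow> real) \<Rightarrow> bool" where
  "jacobs_ladder \<alpha> T0 \<phi>1 \<longleftrightarrow>
     (\<exists>\<phi>. ladder_solution \<alpha> T0 \<phi> \<and> (\<forall>T\<ge>T0. \<phi>1 T = \<phi> T / 2))"

definition abs_Z_tilde :: "(real \<Rightarrow> real) \<Rightarrow> real \<Rightarrow> real" where
  "abs_Z_tilde \<phi>1 t = sqrt (deriv \<phi>1 t)"

(* S_p, with the inverse of \<phi>1 taken on [T0, \<infinity>). *)
definition reverse_iterate :: "real \<Rightarrow> (real \<Rightarrow> real) \<Rightarrow> nat \<Rightarrow> real \<Rightarrow> real" where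
  "reverse_iterate T0 \<phi>1 p S = ((inv_into {T0..} \<phi>1) ^^ p) S"

definition L2_on :: "real set \<Rightarrow> (real \<Rightarrow> real) \<Rightarrow> bool" where
  "L2_on S f \<longleftrightarrow>
     f \<in> borel_measurable (lebesgue_on S) \<and> integrable (lebesgue_on S) (\<lambda>t. (f t)\<^sup>2)"

definition L2_orthogonal_system :: "real set \<Rightarrow> (nat \<Rightarrow> real \<Rightarrow> real) \<Rightarrow> bool" where
  "L2_orthogonal_system S f \<longleftrightarrow>
     (\<forall>n. L2_on S (f n)) \<and>
     (\<forall>m n. m \<noteq> n \<longrightarrow> (LINT t|lebesgue_on S. f m t * f n t) = 0)"

(* The affine bijection from [a, a + 2l] onto [T_p, (T + 2l)_p]. *)
definition ladder_affine ::
    "real \<Rightarrow> (real \<Rightarrow> real) \<Rightarrow> real \<Rightarrow> real \<Rightarrow> nat \<Rightarrow> real \<Rightarrow> real \<Rightarrow> real" where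
  "ladder_affine T0 \<phi>1 a l p T t =
     (reverse_iterate T0 \<phi>1 p (T + 2 * l) - reverse_iterate T0 \<phi>1 p T) / (2 * l) * (t - a)
     + reverse_iterate T0 \<phi>1 p T"

definition transformed_system ::
    "real \<Rightarrow> (real \<Rightarrow> real) \<Rightarrow> real \<Rightarrow> real \<Rightarrow> (nat \<Rightarrow> real \<Rightarrow> real) \<Rightarrow> nat \<Rightarrow> real
      \<Rightarrow> nat \<Rightarrow> real \<Rightarrow> real" where
  "transformed_system T0 \<phi>1 a l f p T n t =
     f n ((\<phi>1 ^^ p) (ladder_affine T0 \<phi>1 a l p T t) - T + a)
     * (\<Prod>r<p. abs_Z_tilde \<phi>1 ((\<phi>1 ^^ r) (ladder_affine T0 \<phi>1 a l p T t)))"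

end

theory Submission imports Defs begin

text \<open>Let \<open>w = |zeta (1/2 + it)|\<^sup>2\<close>. The integral equation reads \<open>F (\<phi> T) = G T\<close>, where
  \<open>G T = \<integral>\<^sub>0\<^sup>T w\<close> and \<open>F\<close> is differentiable with \<open>F' > 0\<close> on \<open>(1, \<infinity>)\<close>, because
  \<open>w\<close> is continuous, nonnegative and, by the identity theorem, not identically zero on any
  interval. Hence \<open>\<phi>1 = \<phi> / 2 = (F\<^sup>-\<^sup>1 \<circ> G) / 2\<close> is strictly increasing and differentiable. By the chain rule
  the product of the \<open>|Z~|\<^sup>2\<close> is the derivative of \<open>\<phi>1\<^sup>p\<close>, so \<open>f\<^sub>n\<^sup>p\<close> is, up to a constant
  factor, \<open>(f\<^sub>n \<circ> h) \<surd>h'\<close> for an increasing bijection \<open>h\<close> of \<open>[a, a + 2l]\<close> onto itself, and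
  the substitution rule preserves all the inner products up to this factor.\<close>

subsection \<open>The zeta function on the critical line\<close>

text \<open>The summands of the continuation
  \<open>\<zeta>(s) = 1/(s - 1) + \<Sum>\<^sub>n (n\<^sup>-\<^sup>s - \<integral> x\<^sup>-\<^sup>s dx)\<close>, with the integrals over \<open>[n, n + 1]\<close>.\<close>
definition zeta_corr :: "nat \<Rightarrow> complex \<Rightarrow> complex" where
  "zeta_corr n s = of_nat (Suc n) powr (-s)
     - (of_nat (Suc (Suc n)) powr (1 - s) - of_nat (Suc n) powr (1 - s)) / (1 - s)"

text \<open>The mean value inequality is applied twice on the segment from \<open>N\<close> to
  \<open>N + 1\<close>: first to \<open>w powr (-s)\<close>, then to a function whose derivative is
  the difference just bounded. The resulting bound is summable for all \<open>Re s > 0\<close>,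
  which carries the series past the line \<open>Re s = 1\<close>.\<close>

lemma norm_zeta_corr_le:
  assumes "Re s > 0" "s \<noteq> 1"
  shows "norm (zeta_corr n s) \<le> norm s * real (Suc n) powr (- Re s - 1)"
proof -
  define N where "N = real (Suc n)"
  define S where "S = closed_segment (of_real N) (of_real (N + 1) :: complex)"
  have N: "N > 0" "N \<ge> 1" by (auto simp: N_def)
  have S: "\<exists>x. z = of_real x \<and> N \<le> x \<and> x \<le> N + 1" if "z \<in> S" for z
    using that N unfolding S_def closed_segment_of_real closed_segment_eq_real_ivl by auto
  have ends: "of_real N \<in> S" "of_real (N + 1) \<in> S" by (auto simp: S_def)
  have cS: "convex S" by (simp add: S_def)
  have slit: "z \<notin> \<real>\<^sub>\<le>\<^sub>0" if "z \<in> S" for z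
    using S[OF that] N by (auto simp: complex_nonpos_Reals_iff)
  define B where "B = norm s * N powr (- Re s - 1)"
  have powr_bound: "norm (of_real N powr (-s) - z powr (-s)) \<le> B" if z: "z \<in> S" for z
  proof -
    have "norm (of_real N powr (-s) - z powr (-s)) \<le> B * norm (of_real N - z)"
    proof (rule field_differentiable_bound[OF cS _ _ ends(1) z])
      fix w assume w: "w \<in> S"
      show "((\<lambda>w. w powr (-s)) has_field_derivative (-s) * w powr (-s - 1)) (at w within S)"
        using slit[OF w] by (auto intro!: derivative_eq_intros)
      obtain x where x: "w = of_real x" "N \<le> x" "x \<le> N + 1" using S[OF w] by blast
      have "norm (w powr (-s - 1)) = x powr (- Re s - 1)"
        using x N by (simp add: norm_powr_real_powr)
      also have "\<dots> \<le> N powr (- Re s - 1)"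
        using x N assms by (intro powr_mono2') auto
      finally show "norm ((-s) * w powr (-s - 1)) \<le> B"
        by (simp add: norm_mult B_def mult_left_mono)
    qed
    also have "\<dots> \<le> B * 1"
    proof (intro mult_left_mono)
      obtain x where x: "z = of_real x" "N \<le> x" "x \<le> N + 1" using S[OF z] by blast
      then have "of_real N - z = complex_of_real (N - x)" by simp
      then show "norm (of_real N - z) \<le> 1" using x by (simp only: norm_of_real)
    qed (simp add: B_def)
    finally show ?thesis by simp
  qed
  \<comment> \<open>The correction term is the increment of \<open>g\<close> over \<open>[N, N + 1]\<close>.\<close>
  define g where "g = (\<lambda>z. z * of_real N powr (-s) - z powr (1 - s) / (1 - s))"
  have "norm (g (of_real (N + 1)) - g (of_real N)) \<le> B * norm (of_real (N + 1) - of_real N :: complex)"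
  proof (rule field_differentiable_bound[OF cS _ powr_bound ends(2) ends(1)])
    fix z assume z: "z \<in> S"
    show "(g has_field_derivative of_real N powr (-s) - z powr (-s)) (at z within S)"
      unfolding g_def using slit[OF z] assms
      by (auto intro!: derivative_eq_intros)
  qed
  also have "g (of_real (N + 1)) - g (of_real N) = zeta_corr n s"
    by (simp add: g_def zeta_corr_def N_def algebra_simps diff_divide_distrib)
  finally show ?thesis by (simp add: B_def N_def)
qed

text \<open>The partial sums are holomorphic and converge uniformly on small discs by the
  Weierstrass M-test.\<close>

lemma zeta_continuation_holomorphic:
  "(\<lambda>s. (\<Sum>n. zeta_corr n s) + 1 / (s - 1)) holomorphic_on ({s. Re s > 0} - {1})"
proof -
  have op: "open ({s. Re s > 0} - {1})"
    by (intro open_Diff open_halfspace_Re_gt) auto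
  have "(\<lambda>s. \<Sum>n. zeta_corr n s) holomorphic_on ({s. Re s > 0} - {1})"
  proof (rule holomorphic_uniform_sequence[OF op])
    show "(\<lambda>s. \<Sum>i<n. zeta_corr i s) holomorphic_on ({s. Re s > 0} - {1})" for n
      unfolding zeta_corr_def by (intro holomorphic_intros) auto
    fix x assume x: "x \<in> {s. Re s > 0} - {1}"
    obtain d0 where d0: "d0 > 0" "cball x d0 \<subseteq> {s. Re s > 0} - {1}"
      using op x open_contains_cball by metis
    \<comment> \<open>A radius of at most \<open>Re x / 2\<close> keeps
      \<open>Re s \<ge> Re x / 2\<close> on the disc, so one exponent below -1 serves the whole
      majorant.\<close>
    define d where "d = min d0 (Re x / 2)"
    have d: "d > 0" "d \<le> Re x / 2" "cball x d \<subseteq> {s. Re s > 0} - {1}"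
      using d0 x by (auto simp: d_def)
    have "uniform_limit (cball x d) (\<lambda>n s. \<Sum>i<n. zeta_corr i s) (\<lambda>s. \<Sum>n. zeta_corr n s) sequentially"
    proof (rule Weierstrass_m_test)
      show "summable (\<lambda>n. (norm x + d) * real (Suc n) powr (- (Re x / 2) - 1))"
        using x by (intro summable_mult) (subst summable_Suc_iff, simp add: summable_real_powr_iff)
      fix n s assume s: "s \<in> cball x d"
      have Re: "Re s \<ge> Re x / 2"
        using s d abs_Re_le_cmod[of "x - s"] by (auto simp: dist_norm)
      have nm: "norm s \<le> norm x + d"
        using s norm_triangle_ineq2[of s x] by (auto simp: dist_norm norm_minus_commute)
      have "norm (zeta_corr n s) \<le> norm s * real (Suc n) powr (- Re s - 1)"
        using s d by (intro norm_zeta_corr_le) auto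
      also have "\<dots> \<le> (norm x + d) * real (Suc n) powr (- (Re x / 2) - 1)"
        using Re nm d by (intro mult_mono powr_mono) auto
      finally show "norm (zeta_corr n s) \<le> \<dots>" .
    qed
    then show "\<exists>d>0. cball x d \<subseteq> {s. 0 < Re s} - {1} \<and>
        uniform_limit (cball x d) (\<lambda>n s. \<Sum>i<n. zeta_corr i s) (\<lambda>s. \<Sum>n. zeta_corr n s) sequentially"
      using d by blast
  qed
  then show ?thesis by (intro holomorphic_intros) auto
qed

lemma zeta_continuation_sums:
  assumes "Re s > 1"
  shows "(\<lambda>n. 1 / of_nat (Suc n) powr s) sums ((\<Sum>n. zeta_corr n s) + 1 / (s - 1))"
proof -
  have s: "s \<noteq> 1" using assms by auto
  have summ: "summable (\<lambda>n. zeta_corr n s)"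
  proof (rule summable_comparison_test')
    show "summable (\<lambda>n. norm s * real (Suc n) powr (- Re s - 1))"
      using assms by (intro summable_mult) (subst summable_Suc_iff, simp add: summable_real_powr_iff)
    show "norm (zeta_corr n s) \<le> norm s * real (Suc n) powr (- Re s - 1)" if "n \<ge> 0" for n
      using assms s by (intro norm_zeta_corr_le) auto
  qed
  \<comment> \<open>The increments of \<open>q\<close> are the integrals subtracted in
    \<open>zeta_corr\<close>. They telescope to \<open>- q 0\<close>, as \<open>q\<close> tends to 0
    for \<open>Re s > 1\<close>; this is the pole term \<open>1 / (s - 1)\<close>.\<close>
  define q :: "nat \<Rightarrow> complex" where "q = (\<lambda>n. of_nat (Suc n) powr (1 - s) / (1 - s))"
  have "(\<lambda>n. norm (q n)) \<longlonglongrightarrow> 0"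
  proof -
    have "norm (q n) = real (Suc n) powr (1 - Re s) / norm (1 - s)" for n
      by (simp add: q_def norm_divide norm_powr_real_powr del: of_nat_Suc)
    moreover have "(\<lambda>n. real (Suc n) powr (1 - Re s) / norm (1 - s)) \<longlonglongrightarrow> 0 / norm (1 - s)"
      using assms s
      by (intro tendsto_divide tendsto_const tendsto_neg_powr
            filterlim_compose[OF filterlim_real_sequentially filterlim_Suc]) auto
    ultimately show ?thesis by simp
  qed
  then have "q \<longlonglongrightarrow> 0" by (simp add: tendsto_norm_zero_iff)
  then have "(\<lambda>n. q (Suc n) - q n) sums (0 - q 0)" by (rule telescope_sums)
  from sums_add[OF summable_sums[OF summ] this]
  have "(\<lambda>n. zeta_corr n s + (q (Suc n) - q n)) sums ((\<Sum>n. zeta_corr n s) - 1 / (1 - s))"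
    by (simp add: q_def)
  moreover have "zeta_corr n s + (q (Suc n) - q n) = 1 / of_nat (Suc n) powr s" for n
    by (simp add: zeta_corr_def q_def diff_divide_distrib powr_minus_divide)
  moreover have "(\<Sum>n. zeta_corr n s) - 1 / (1 - s) = (\<Sum>n. zeta_corr n s) + 1 / (s - 1)"
    by (metis diff_conv_add_uminus minus_diff_eq minus_divide_right)
  ultimately show ?thesis by (simp del: of_nat_Suc)
qed

text \<open>The series with its pole term is a witness for the choice in the definition of
  \<open>zeta\<close>, so the chosen function has both defining properties.\<close>

lemma
  shows zeta_holomorphic: "zeta holomorphic_on ({s. Re s > 0} - {1})"
    and zeta_sums: "Re s > 1 \<Longrightarrow> (\<lambda>n. 1 / of_nat (Suc n) powr s) sums zeta s"
proof -
  have "\<exists>f. f holomorphic_on ({s. Re s > 0} - {1}) \<and>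
                   (\<forall>s. Re s > 1 \<longrightarrow> (\<lambda>n. 1 / of_nat (Suc n) powr s) sums f s)"
    using zeta_continuation_holomorphic zeta_continuation_sums by blast
  from someI_ex[OF this, folded zeta_def]
  show "zeta holomorphic_on ({s. Re s > 0} - {1})"
    and "Re s > 1 \<Longrightarrow> (\<lambda>n. 1 / of_nat (Suc n) powr s) sums zeta s"
    by blast+
qed

text \<open>Supplies a point where \<open>zeta\<close> is certainly nonzero, to contradict identical
  vanishing.\<close>

lemma zeta_2: "zeta 2 = of_real (pi\<^sup>2 / 6)"
proof -
  have "(\<lambda>n. 1 / of_nat (Suc n) powr 2) sums zeta 2"
    by (rule zeta_sums) simp
  moreover have "1 / of_nat (Suc n) powr 2 = (of_real (1 / (real n + 1)\<^sup>2) :: complex)" for n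
    by (subst powr_complexnumeral) (simp_all add: add.commute del: of_nat_Suc, simp add: add.commute)
  ultimately have "(\<lambda>n. of_real (1 / (real n + 1)\<^sup>2)) sums zeta 2"
    by (simp only:)
  moreover have "real ((n + 1)\<^sup>2) = (real n + 1)\<^sup>2" for n
    by simp
  ultimately show ?thesis
    using sums_of_real[OF inverse_squares_sums, where ?'a = complex] by (simp only: sums_unique2)
qed

section \<open>Continuity and non-vanishing of Hardy's function\<close>

lemma norm_hardy_Z: "norm (hardy_Z t) = norm (zeta (1/2 + \<i> * of_real t))"
  by (simp add: hardy_Z_def norm_mult norm_exp_i_times)

lemma continuous_on_norm_hardy_Z_sq: "continuous_on A (\<lambda>t. (norm (hardy_Z t))\<^sup>2)"
proof -
  have "continuous_on A (\<lambda>t. zeta (1/2 + \<i> * of_real t))"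
    by (rule continuous_on_compose2[OF holomorphic_on_imp_continuous_on[OF zeta_holomorphic]])
       (auto intro!: continuous_intros simp: complex_eq_iff)
  then show ?thesis unfolding norm_hardy_Z by (intro continuous_intros)
qed

text \<open>Zeros filling an interval would accumulate inside the connected region of holomorphy,
  and the identity theorem would force \<open>zeta 2 = 0\<close>.\<close>

lemma hardy_Z_nonzero_in_interval:
  assumes "a < b"
  shows "\<exists>t\<in>{a..b}. hardy_Z t \<noteq> 0"
proof (rule ccontr)
  assume "\<not> ?thesis"
  then have 0: "zeta (1/2 + \<i> * of_real t) = 0" if "t \<in> {a..b}" for t
    using that norm_hardy_Z[of t] by auto
  define U where "U = (\<lambda>t. 1/2 + \<i> * complex_of_real t) ` {a..b}"
  have "a islimpt {a..b}" using assms by (simp add: islimpt_Icc)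
  then have "(1/2 + \<i> * complex_of_real a) islimpt U"
    unfolding U_def
    by (rule islimpt_isCont_image) (auto intro!: continuous_intros simp: eventually_at_filter)
  moreover have "open ({s. Re s > 0} - {1})"
    by (intro open_Diff open_halfspace_Re_gt) auto
  moreover have "connected ({s. Re s > 0} - {1})"
    by (intro connected_open_delete open_halfspace_Re_gt convex_connected convex_halfspace_Re_gt) auto
  moreover have "U \<subseteq> {s. Re s > 0} - {1}"
    by (auto simp: U_def complex_eq_iff)
  moreover have "1/2 + \<i> * complex_of_real a \<in> {s. Re s > 0} - {1}"
    by (auto simp: complex_eq_iff)
  moreover have "zeta z = 0" if "z \<in> U" for z
    using that 0 by (auto simp: U_def)
  ultimately have "zeta 2 = 0"
    using analytic_continuation[OF zeta_holomorphic, of U "1/2 + \<i> * complex_of_real a" 2] by auto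
  then show False by (simp add: zeta_2)
qed

subsection \<open>Differentiability of Jacob's ladder\<close>

text \<open>A continuous nonnegative function with integral 0 vanishes identically, so one nonzero
  value is enough.\<close>

lemma integral_pos_of_continuous:
  fixes g :: "real \<Rightarrow> real"
  assumes "continuous_on {a..b} g" "a < b" "\<And>t. t \<in> {a..b} \<Longrightarrow> g t \<ge> 0"
    and "t \<in> {a..b}" "g t \<noteq> 0"
  shows "integral {a..b} g > 0"
proof -
  have "integral {a..b} g \<noteq> 0"
    using integral_eq_0_iff[of a b g] assms by blast
  moreover have "integral {a..b} g \<ge> 0"
    using assms by (intro integral_nonneg integrable_continuous_interval) auto
  ultimately show ?thesis by linarith
qed

lemma has_real_derivative_integral_upper_limit:
  fixes g :: "real \<Rightarrow> real"
  assumes "continuous_on UNIV g" "u > 0"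
  shows "((\<lambda>u. integral {0..u} g) has_real_derivative g u) (at u)"
proof -
  \<comment> \<open>The interval is extended to \<open>u + 1\<close> so that \<open>u\<close> is
    interior and the derivative is two-sided.\<close>
  have "((\<lambda>u. integral {0..u} g) has_real_derivative g u) (at u within {0..u + 1})"
    using assms by (intro integral_has_real_derivative) (auto intro: continuous_on_subset)
  then show ?thesis
    using assms by (metis add.commute at_within_Icc_at less_add_one)
qed

text \<open>Since \<open>x\<close> enters both the upper limit and the exponent, the integral is
  treated as a function \<open>H x u\<close> of two independent variables, differentiated through
  its partial derivatives and composed with the curve \<open>(x, \<mu> x)\<close>.\<close>

lemma has_real_derivative_integral_exp:
  fixes w \<mu> :: "real \<Rightarrow> real"
  assumes w: "continuous_on UNIV w" and x: "x > 0" and mu: "\<mu> x > 0"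
    and der: "(\<mu> has_real_derivative \<mu>') (at x)"
  shows "((\<lambda>x. integral {0..\<mu> x} (\<lambda>t. w t * exp (- (2 / x) * t))) has_real_derivative
           w (\<mu> x) * exp (- (2 / x) * \<mu> x) * \<mu>'
           + integral {0..\<mu> x} (\<lambda>t. w t * (exp (- (2 / x) * t) * (2 * t / x\<^sup>2)))) (at x)"
proof -
  define H where "H = (\<lambda>x u. integral {0..u} (\<lambda>t. w t * exp (- (2 / x) * t)))"
  define D where "D = integral {0..\<mu> x} (\<lambda>t. w t * (exp (- (2 / x) * t) * (2 * t / x\<^sup>2)))"
  define E where "E = (\<lambda>x u. w u * exp (- (2 / x) * u))"
  note w' = continuous_on_compose2[OF w]
  \<comment> \<open>The partial derivative in the first variable is Leibniz's rule over a fixed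
    interval.\<close>
  have fx: "((\<lambda>y. H y (\<mu> x)) has_derivative (*) D) (at x within {0<..})"
  proof -
    have "((\<lambda>y. integral (cbox 0 (\<mu> x)) (\<lambda>t. w t * exp (- (2 / y) * t))) has_field_derivative
        integral (cbox 0 (\<mu> x)) (\<lambda>t. w t * (exp (- (2 / x) * t) * (2 * t / x\<^sup>2)))) (at x within {0<..})"
    proof (rule leibniz_rule_field_derivative)
      show "((\<lambda>y. w t * exp (- (2 / y) * t)) has_field_derivative
          w t * (exp (- (2 / y) * t) * (2 * t / y\<^sup>2))) (at y within {0<..})" if "y \<in> {0<..}" for y t
        using that by (auto intro!: derivative_eq_intros simp: power2_eq_square)
      show "(\<lambda>t. w t * exp (- (2 / y) * t)) integrable_on cbox 0 (\<mu> x)" for y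
        by (intro integrable_continuous continuous_intros w') auto
      show "continuous_on ({0<..} \<times> cbox 0 (\<mu> x))
          (\<lambda>(y, t). w t * (exp (- (2 / y) * t) * (2 * t / y\<^sup>2)))"
        unfolding case_prod_beta by (intro continuous_intros w') auto
    qed (use x in auto)
    then show ?thesis
      by (simp add: H_def D_def has_field_derivative_def)
  qed
  \<comment> \<open>Total differentiability follows from one partial derivative at the point and a
    jointly continuous other one. Continuity is that of a map into bounded linear operators, hence
    \<open>blinfun_scaleR_left\<close>.\<close>
  have "((\<lambda>(x, u). H x u) has_derivative (\<lambda>(tx, tu). D * tx + blinfun_scaleR_left (E x (\<mu> x)) tu))
      (at (x, \<mu> x) within {0<..} \<times> {0<..})"
  proof (rule has_derivative_partialsI)
    show "((\<lambda>y. H y (\<mu> x)) has_derivative (*) D) (at x within {0<..})"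
      by (fact fx)
    show "(H y has_derivative blinfun_apply (blinfun_scaleR_left (E y u))) (at u within {0<..})"
      if "y \<in> {0<..}" "u \<in> {0<..}" for y u
    proof -
      have "(H y has_real_derivative E y u) (at u)"
        unfolding H_def E_def using that
        by (intro has_real_derivative_integral_upper_limit continuous_intros w') auto
      then show ?thesis
        by (auto simp: has_field_derivative_def mult.commute[of _ "E y u"]
            intro: has_derivative_at_withinI)
    qed
    have "continuous_on ({0<..} \<times> {0<..}) (\<lambda>(y, u). blinfun_scaleR_left (E y u))"
      unfolding case_prod_beta E_def
      by (intro bounded_linear.continuous_on[OF bounded_linear_blinfun_scaleR_left]
          continuous_intros w') auto
    then show "continuous (at (x, \<mu> x) within {0<..} \<times> {0<..}) (\<lambda>(y, u). blinfun_scaleR_left (E y u))"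
      using x mu by (simp add: continuous_on_eq_continuous_within)
  qed (use mu in auto)
  then have "((\<lambda>(x, u). H x u) has_derivative (\<lambda>(tx, tu). D * tx + tu * E x (\<mu> x))) (at (x, \<mu> x))"
    using x mu by (subst (asm) at_within_open) (auto intro: open_Times)
  moreover have "((\<lambda>x. (x, \<mu> x)) has_derivative (\<lambda>h. (h, \<mu>' * h))) (at x)"
    using der by (intro has_derivative_Pair has_derivative_ident) (simp add: has_field_derivative_def)
  ultimately have "((\<lambda>x. case (x, \<mu> x) of (x, u) \<Rightarrow> H x u) has_derivative
      (\<lambda>h. case (h, \<mu>' * h) of (tx, tu) \<Rightarrow> D * tx + tu * E x (\<mu> x))) (at x)"
    by (rule has_derivative_compose[rotated])
  moreover have "(\<lambda>h. case (h, \<mu>' * h) of (tx, tu) \<Rightarrow> D * tx + tu * E x (\<mu> x)) =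
      (*) (E x (\<mu> x) * \<mu>' + D)"
    by (auto simp: algebra_simps)
  ultimately show ?thesis
    by (simp add: has_field_derivative_def H_def E_def D_def)
qed

text \<open>Collects all that is used of the integral equation later. The derivative is only claimed
  nonnegative because it vanishes wherever \<open>zeta\<close> has a zero on the critical
  line.\<close>

lemma jacobs_ladder_properties:
  assumes \<alpha>: "\<alpha> > 0" and ladder: "jacobs_ladder \<alpha> T0 \<phi>1"
  shows "strict_mono_on {T0..} \<phi>1"
    and "filterlim \<phi>1 at_top at_top"
    and "T > T0 \<Longrightarrow> (\<phi>1 has_real_derivative deriv \<phi>1 T) (at T)"
    and "T > T0 \<Longrightarrow> deriv \<phi>1 T \<ge> 0"
proof -
  obtain \<phi> where "ladder_solution \<alpha> T0 \<phi>" and \<phi>1: "\<And>T. T \<ge> T0 \<Longrightarrow> \<phi>1 T = \<phi> T / 2"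
    using ladder unfolding jacobs_ladder_def by blast
  define w where "w = (\<lambda>t. (cmod (hardy_Z t))\<^sup>2)"
  define F where "F = (\<lambda>x. integral {0..ladder_mu \<alpha> x} (\<lambda>t. w t * exp (- (2 / x) * t)))"
  define G where "G = (\<lambda>T. integral {0..T} w)"
  have T0: "T0 > 0" and lim: "filterlim \<phi> at_top at_top"
    and pos: "\<And>T. T \<ge> T0 \<Longrightarrow> \<phi> T > 0" and eq: "\<And>T. T \<ge> T0 \<Longrightarrow> F (\<phi> T) = G T"
    using \<open>ladder_solution \<alpha> T0 \<phi>\<close> unfolding ladder_solution_def F_def G_def w_def by auto
  have w: "continuous_on A w" for A
    unfolding w_def by (rule continuous_on_norm_hardy_Z_sq)
  have w0: "w t \<ge> 0" for t by (simp add: w_def)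
  have w1: "\<exists>t\<in>{a..b}. w t \<noteq> 0" if "a < b" for a b
    using hardy_Z_nonzero_in_interval[OF that] by (simp add: w_def)

  have G_pos: "integral {a..b} w > 0" if ab: "a < b" for a b
    using w1[OF ab] integral_pos_of_continuous[OF w ab w0] by blast
  have G_mono: "G S < G T" if "0 \<le> S" "S < T" for S T
  proof -
    have "G S + integral {S..T} w = G T"
      unfolding G_def using that
      by (intro Henstock_Kurzweil_Integration.integral_combine integrable_continuous_interval w) auto
    then show ?thesis using G_pos[OF that(2)] by linarith
  qed
  have G_deriv: "(G has_real_derivative w T) (at T)" if "T > 0" for T
    unfolding G_def by (intro has_real_derivative_integral_upper_limit w that)

  have F_deriv: "\<exists>D>0. (F has_real_derivative D) (at x)" if x: "x > 1" for x
  proof -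
    let ?m = "ladder_mu \<alpha> x"
    have m: "?m > 0" using x \<alpha> by (simp add: ladder_mu_def)
    have der: "(ladder_mu \<alpha> has_real_derivative \<alpha> * (ln x + 1)) (at x)"
      unfolding ladder_mu_def using x
      by (auto intro!: derivative_eq_intros simp: algebra_simps)
    \<comment> \<open>The point is sought in the upper half of the interval so that
      \<open>t > 0\<close> and the factor \<open>2 * t / x\<^sup>2\<close> does not vanish
      there.\<close>
    obtain t where t: "t \<in> {?m / 2..?m}" "w t \<noteq> 0" using w1[of "?m / 2" ?m] m by auto
    have "integral {0..?m} (\<lambda>t. w t * (exp (- (2 / x) * t) * (2 * t / x\<^sup>2))) > 0"
      by (rule integral_pos_of_continuous[where t = t])
         (use m x t in \<open>auto intro!: continuous_intros w mult_nonneg_nonneg divide_nonneg_nonneg w0\<close>)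
    moreover have "w ?m * exp (- (2 / x) * ?m) * (\<alpha> * (ln x + 1)) \<ge> 0"
      using x \<alpha> by (intro mult_nonneg_nonneg w0) auto
    moreover note has_real_derivative_integral_exp[OF w _ m der, folded F_def]
    ultimately show ?thesis
      using x by (meson add_nonneg_pos less_trans zero_less_one)
  qed
  have F_mono: "F x < F y" if "1 < x" "x < y" for x y
    by (rule DERIV_pos_imp_increasing[OF that(2)]) (meson F_deriv that less_le_trans)
  \<comment> \<open>For \<open>\<phi> T \<le> 1\<close> the logarithm makes the upper limit
    nonpositive, so \<open>F\<close> would be 0 while \<open>G\<close> is positive. Thus
    \<open>\<phi>\<close> stays where \<open>F\<close> is strictly increasing.\<close>
  have \<phi>_gt: "\<phi> T > 1" if T: "T \<ge> T0" for T
  proof (rule ccontr)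
    assume "\<not> \<phi> T > 1"
    then have "ladder_mu \<alpha> (\<phi> T) \<le> 0"
      using pos[OF T] \<alpha> by (simp add: ladder_mu_def mult_nonneg_nonpos)
    then have "F (\<phi> T) = 0"
      unfolding F_def by (cases "ladder_mu \<alpha> (\<phi> T) = 0") auto
    moreover have "G T > 0" using G_pos[of 0 T] T T0 by (simp add: G_def)
    ultimately show False using eq[OF T] by simp
  qed
  have \<phi>_mono: "\<phi> S < \<phi> T" if "T0 \<le> S" "S < T" for S T
  proof -
    have "F (\<phi> S) < F (\<phi> T)" using eq G_mono[of S T] that T0 by simp
    then show ?thesis
      using F_mono[of "\<phi> T" "\<phi> S"] \<phi>_gt that
      by (metis less_eq_real_def linorder_not_less order.asym order.trans)
  qed
  show "strict_mono_on {T0..} \<phi>1"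
    using \<phi>_mono by (auto simp: strict_mono_on_def \<phi>1)
  have "filterlim (\<lambda>T. \<phi> T * (1 / 2)) at_top at_top"
    by (rule filterlim_at_top_mult_tendsto_pos[OF tendsto_const _ lim]) simp
  then show "filterlim \<phi>1 at_top at_top"
    by (rule filterlim_mono_eventually)
       (auto simp: \<phi>1 intro: eventually_mono[OF eventually_ge_at_top[of T0]])

  have "\<exists>D\<ge>0. (\<phi>1 has_real_derivative D) (at T)" if T: "T > T0" for T
  proof -
    obtain D where D: "D > 0" "(F has_real_derivative D) (at (\<phi> T))"
      using F_deriv \<phi>_gt T by (meson less_imp_le)
    have inj: "inj_on F {1<..}"
      by (rule linorder_inj_onI) (use F_mono in \<open>fastforce+\<close>)
    \<comment> \<open>The inverse function theorem: \<open>F\<close> is continuous and injective on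
      an open ray and has derivative \<open>D > 0\<close> at \<open>\<phi> T\<close>.\<close>
    have "(inv_into {1<..} F has_real_derivative inverse D) (at (F (\<phi> T)))"
    proof (rule has_field_derivative_inverse_strong[OF D(2)])
      show "continuous_on {1<..} F"
        by (meson F_deriv DERIV_isCont continuous_at_imp_continuous_on greaterThan_iff)
    qed (use D \<phi>_gt T inj in auto)
    then have "(inv_into {1<..} F has_real_derivative inverse D) (at (G T))"
      using eq T by simp
    from DERIV_cdivide[OF DERIV_chain2[OF this G_deriv], of 2]
    have "((\<lambda>T. inv_into {1<..} F (G T) / 2) has_real_derivative inverse D * w T / 2) (at T)"
      using T T0 by simp
    \<comment> \<open>The identity with \<open>\<phi>1\<close> holds on the open ray beyond
      \<open>T0\<close>, a neighbourhood of \<open>T\<close>, so the derivative transfers.\<close>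
    moreover have "inv_into {1<..} F (G S) / 2 = \<phi>1 S" if "S \<in> {T0<..}" for S
      using that inj \<phi>_gt by (simp add: \<phi>1 flip: eq)
    ultimately have "(\<phi>1 has_real_derivative inverse D * w T / 2) (at T)"
      using has_field_derivative_transform_within_open[of _ _ T "{T0<..}" \<phi>1] T by auto
    moreover have "inverse D * w T / 2 \<ge> 0" using D w0 by simp
    ultimately show ?thesis by blast
  qed
  then show "T > T0 \<Longrightarrow> (\<phi>1 has_real_derivative deriv \<phi>1 T) (at T)"
    and "T > T0 \<Longrightarrow> deriv \<phi>1 T \<ge> 0"
    using DERIV_imp_deriv by metis+
qed

subsection \<open>Change of variables for orthogonal systems\<close>

text \<open>The product is dominated by the sum of the two squares.\<close>

lemma L2_on_mult_integrable:
  assumes "L2_on S f" "L2_on S g"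
  shows "integrable (lebesgue_on S) (\<lambda>t. f t * g t)"
proof (rule Bochner_Integration.integrable_bound)
  show "integrable (lebesgue_on S) (\<lambda>t. (f t)\<^sup>2 + (g t)\<^sup>2)"
    using assms by (auto simp: L2_on_def)
  show "(\<lambda>t. f t * g t) \<in> borel_measurable (lebesgue_on S)"
    using assms by (auto simp: L2_on_def)
  have "\<bar>x * y\<bar> \<le> x\<^sup>2 + y\<^sup>2" for x y :: real
    using sum_squares_bound[of "\<bar>x\<bar>" "\<bar>y\<bar>"] mult_nonneg_nonneg[of "\<bar>x\<bar>" "\<bar>y\<bar>"]
    unfolding abs_mult power2_abs by linarith
  then show "AE t in lebesgue_on S. norm (f t * g t) \<le> norm ((f t)\<^sup>2 + (g t)\<^sup>2)"
    by auto
qed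

text \<open>The substitution rule for absolutely integrable functions, transferred to Lebesgue
  integrals over \<open>lebesgue_on\<close>.\<close>

lemma integrable_change_of_variables:
  fixes h u :: "real \<Rightarrow> real"
  assumes S: "S \<in> sets lebesgue" "h ` S \<in> sets lebesgue"
    and der: "\<And>t. t \<in> S \<Longrightarrow> (h has_real_derivative h' t) (at t within S)"
    and inj: "inj_on h S"
    and u: "integrable (lebesgue_on (h ` S)) u"
  shows "integrable (lebesgue_on S) (\<lambda>t. \<bar>h' t\<bar> * u (h t))"
    and "(LINT t|lebesgue_on S. \<bar>h' t\<bar> * u (h t)) = (LINT t|lebesgue_on (h ` S). u t)"
proof -
  have "u absolutely_integrable_on (h ` S)"
    using u S by (simp add: set_integrable_def integrable_restrict_space)
  then have *: "(\<lambda>t. \<bar>h' t\<bar> * u (h t)) absolutely_integrable_on S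
      \<and> integral S (\<lambda>t. \<bar>h' t\<bar> * u (h t)) = integral (h ` S) u"
    using has_absolute_integral_change_of_variables_1'[OF S(1) der inj, of u "integral (h ` S) u"]
    by simp
  then show i: "integrable (lebesgue_on S) (\<lambda>t. \<bar>h' t\<bar> * u (h t))"
    using absolutely_integrable_imp_integrable S by blast
  show "(LINT t|lebesgue_on S. \<bar>h' t\<bar> * u (h t)) = (LINT t|lebesgue_on (h ` S). u t)"
    using * lebesgue_integral_eq_integral[OF i S(1)] lebesgue_integral_eq_integral[OF u S(2)]
    by simp
qed

text \<open>The Jacobian \<open>c * q t\<close> is shared as one \<open>sqrt (q t)\<close> per
  factor, so every inner product is divided by \<open>c\<close>. The case \<open>m = n\<close> gives
  square integrability.\<close>

lemma L2_orthogonal_system_change_of_variables: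
  fixes h q :: "real \<Rightarrow> real"
  assumes S: "S \<in> sets lebesgue" "h ` S \<in> sets lebesgue"
    and der: "\<And>t. t \<in> S \<Longrightarrow> (h has_real_derivative c * q t) (at t within S)"
    and inj: "inj_on h S"
    and c: "c > 0" and q: "\<And>t. t \<in> S \<Longrightarrow> q t \<ge> 0"
    and f: "L2_orthogonal_system (h ` S) f"
  shows "L2_orthogonal_system S (\<lambda>n t. f n (h t) * sqrt (q t))"
proof -
  have L2: "L2_on (h ` S) (f n)" for n
    using f by (simp add: L2_orthogonal_system_def)
  note cov = integrable_change_of_variables[OF S der inj]
  have eq: "\<bar>c * q t\<bar> * (f m (h t) * f n (h t))
      = c * ((f m (h t) * sqrt (q t)) * (f n (h t) * sqrt (q t)))" if "t \<in> S" for m n t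
    using q[OF that] c by (simp add: algebra_simps flip: power2_eq_square)
  have int: "integrable (lebesgue_on S) (\<lambda>t. (f m (h t) * sqrt (q t)) * (f n (h t) * sqrt (q t)))"
    and LINT: "(LINT t|lebesgue_on S. (f m (h t) * sqrt (q t)) * (f n (h t) * sqrt (q t)))
      = (LINT t|lebesgue_on (h ` S). f m t * f n t) / c" for m n
  proof -
    note mn = L2_on_mult_integrable[OF L2[of m] L2[of n]]
    have "integrable (lebesgue_on S)
        (\<lambda>t. c * ((f m (h t) * sqrt (q t)) * (f n (h t) * sqrt (q t))))"
      using cov(1)[OF _ mn] by (subst Bochner_Integration.integrable_cong[OF refl eq[symmetric]]) auto
    then show "integrable (lebesgue_on S) (\<lambda>t. (f m (h t) * sqrt (q t)) * (f n (h t) * sqrt (q t)))"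
      using c by simp
    have "(LINT t|lebesgue_on (h ` S). f m t * f n t)
      = (LINT t|lebesgue_on S. c * ((f m (h t) * sqrt (q t)) * (f n (h t) * sqrt (q t))))"
      using cov(2)[OF _ mn] by (subst Bochner_Integration.integral_cong[OF refl eq[symmetric]]) auto
    then show "(LINT t|lebesgue_on S. (f m (h t) * sqrt (q t)) * (f n (h t) * sqrt (q t)))
      = (LINT t|lebesgue_on (h ` S). f m t * f n t) / c"
      using c by simp
  qed
  \<comment> \<open>Composition with \<open>h\<close> need not preserve Lebesgue measurability, so measurability of the
    product is recovered from that of its signed square, to which the change of variables applies.\<close>
  have meas: "(\<lambda>t. f n (h t) * sqrt (q t)) \<in> borel_measurable (lebesgue_on S)" for n
  proof -
    have "integrable (lebesgue_on (h ` S)) (\<lambda>t. f n t * \<bar>f n t\<bar>)"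
      using L2[of n] by (intro L2_on_mult_integrable) (auto simp: L2_on_def)
    from cov(1)[OF _ this]
    have "(\<lambda>t. \<bar>c * q t\<bar> * (f n (h t) * \<bar>f n (h t)\<bar>)) \<in> borel_measurable (lebesgue_on S)"
      by auto
    then have "(\<lambda>t. sgn (\<bar>c * q t\<bar> * (f n (h t) * \<bar>f n (h t)\<bar>))
        * sqrt (\<bar>\<bar>c * q t\<bar> * (f n (h t) * \<bar>f n (h t)\<bar>)\<bar> / c)) \<in> borel_measurable (lebesgue_on S)"
      unfolding sgn_real_def by measurable
    moreover have "sgn (\<bar>c * q t\<bar> * (x * \<bar>x\<bar>)) * sqrt (\<bar>\<bar>c * q t\<bar> * (x * \<bar>x\<bar>)\<bar> / c) = x * sqrt (q t)"
      if "t \<in> S" for t x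
    proof -
      have "sqrt (\<bar>\<bar>c * q t\<bar> * (x * \<bar>x\<bar>)\<bar> / c) = \<bar>x\<bar> * sqrt (q t)"
        using q[OF that] c by (simp add: abs_mult real_sqrt_mult)
      \<comment> \<open>Where \<open>q t = 0\<close> the sign is 0 and \<open>x\<close> is lost,
        harmlessly, since \<open>sqrt (q t)\<close> is 0 there too.\<close>
      moreover have "sgn (\<bar>c * q t\<bar> * (x * \<bar>x\<bar>)) * \<bar>x\<bar> = (if q t = 0 then 0 else x)"
        using c by (auto simp: sgn_mult mult.assoc sgn_mult_abs)
      ultimately show ?thesis
        by (simp add: mult.assoc[symmetric])
    qed
    ultimately show ?thesis
      by (subst measurable_cong) auto
  qed
  show ?thesis
    unfolding L2_orthogonal_system_def L2_on_def
    using int LINT meas f by (auto simp: power2_eq_square L2_orthogonal_system_def)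
qed

subsection \<open>Iterates of the ladder\<close>

lemma reverse_iterate_Suc:
  "reverse_iterate T0 \<phi> (Suc p) S = inv_into {T0..} \<phi> (reverse_iterate T0 \<phi> p S)"
  by (simp add: reverse_iterate_def)

text \<open>The intermediate value theorem on \<open>[b, c]\<close> with \<open>c\<close> far out
  yields a preimage at or beyond \<open>b\<close>; injectivity on the whole ray from
  \<open>T0\<close> makes it the one chosen by \<open>inv_into\<close>.\<close>

lemma inv_into_ge_and_right_inverse:
  fixes \<phi> :: "real \<Rightarrow> real"
  assumes mono: "strict_mono_on {T0..} \<phi>" and lim: "filterlim \<phi> at_top at_top"
    and cont: "continuous_on {b..} \<phi>" and b: "T0 \<le> b" and S: "S \<ge> \<phi> b"
  shows "inv_into {T0..} \<phi> S \<ge> b" "\<phi> (inv_into {T0..} \<phi> S) = S"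
proof -
  have inj: "inj_on \<phi> {T0..}" using mono by (rule strict_mono_on_imp_inj_on)
  obtain c where c: "c \<ge> b" "\<phi> c \<ge> S"
    using eventually_conj[OF eventually_ge_at_top[of b] filterlim_at_top[THEN iffD1, OF lim, rule_format, of S]]
    by (auto dest!: eventually_happens)
  have "continuous_on {b..c} \<phi>" using cont by (rule continuous_on_subset) auto
  then obtain x where "b \<le> x" "\<phi> x = S"
    using IVT'[of \<phi> b S c] c S by auto
  then show "inv_into {T0..} \<phi> S \<ge> b" "\<phi> (inv_into {T0..} \<phi> S) = S"
    using inj b by auto
qed

text \<open>The preceding lemma with \<open>Z\<close> in place of \<open>b\<close> bounds the
  inverse below by \<open>Z\<close> from \<open>\<phi> Z\<close> on.\<close>

lemma filterlim_inv_into_at_top: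
  fixes \<phi> :: "real \<Rightarrow> real"
  assumes "strict_mono_on {T0..} \<phi>" "filterlim \<phi> at_top at_top" "continuous_on {b..} \<phi>" "T0 \<le> b"
  shows "filterlim (inv_into {T0..} \<phi>) at_top at_top"
  unfolding filterlim_at_top_ge[of _ _ b]
proof safe
  fix Z assume Z: "b \<le> Z"
  show "\<forall>\<^sub>F S in at_top. Z \<le> inv_into {T0..} \<phi> S"
    using eventually_ge_at_top[of "\<phi> Z"]
  proof eventually_elim
    case (elim S)
    then show ?case
      by (intro inv_into_ge_and_right_inverse(1)[OF assms(1,2)]) (use assms Z in \<open>auto intro: continuous_on_subset\<close>)
  qed
qed

lemma strict_mono_on_Icc_image:
  fixes h :: "real \<Rightarrow> real"
  assumes "strict_mono_on {c..d} h" "continuous_on {c..d} h" "c \<le> d"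
  shows "h ` {c..d} = {h c..h d}"
proof (intro subset_antisym subsetI)
  show "y \<in> {h c..h d}" if "y \<in> h ` {c..d}" for y
    using that assms(3) by (auto intro!: mono_onD[OF strict_mono_on_imp_mono_on[OF assms(1)]])
  show "y \<in> h ` {c..d}" if "y \<in> {h c..h d}" for y
    using IVT'[of h c y d] that assms by force
qed

text \<open>Induction on \<open>p\<close>: \<open>\<phi>\<close> maps each reverse interval into the
  previous one, and the chain rule adds one factor. The bound \<open>\<phi> b\<close> on the earlier
  reverse iterates keeps each new interval in the ray from \<open>b > T0\<close>, where
  \<open>\<phi>\<close> is differentiable.\<close>

lemma iterate_on_reverse_interval:
  fixes \<phi> :: "real \<Rightarrow> real"
  assumes mono: "strict_mono_on {T0..} \<phi>" and lim: "filterlim \<phi> at_top at_top"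
    and der: "\<And>x. x > T0 \<Longrightarrow> (\<phi> has_real_derivative deriv \<phi> x) (at x)"
    and nonneg: "\<And>x. x > T0 \<Longrightarrow> deriv \<phi> x \<ge> 0"
    and b: "b > T0"
    and S: "S < U" and large: "\<And>r. r < p \<Longrightarrow> reverse_iterate T0 \<phi> r S \<ge> \<phi> b"
  defines "c \<equiv> reverse_iterate T0 \<phi> p S" and "d \<equiv> reverse_iterate T0 \<phi> p U"
  shows "c < d \<and> strict_mono_on {c..d} (\<phi> ^^ p) \<and> (\<phi> ^^ p) c = S \<and> (\<phi> ^^ p) d = U \<and>
    (\<forall>x\<in>{c..d}. ((\<phi> ^^ p) has_real_derivative (\<Prod>r<p. deriv \<phi> ((\<phi> ^^ r) x))) (at x) \<and>
       (\<forall>r<p. deriv \<phi> ((\<phi> ^^ r) x) \<ge> 0))"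
  using large unfolding c_def d_def
proof (induction p)
  case 0
  then show ?case using S by (auto simp: reverse_iterate_def strict_mono_on_def)
next
  case (Suc p)
  define c where "c = reverse_iterate T0 \<phi> p S"
  define d where "d = reverse_iterate T0 \<phi> p U"
  define c' where "c' = reverse_iterate T0 \<phi> (Suc p) S"
  define d' where "d' = reverse_iterate T0 \<phi> (Suc p) U"
  note IH = Suc.IH[OF Suc.prems, OF less_SucI, folded c_def d_def]
  have cd: "c < d" and c: "c \<ge> \<phi> b" using IH Suc.prems[of p] by (auto simp: c_def)
  have cont: "continuous_on {b..} \<phi>"
    using b by (intro continuous_at_imp_continuous_on ballI DERIV_isCont[OF der]) auto
  note inv = inv_into_ge_and_right_inverse[OF mono lim cont less_imp_le[OF b]]
  have c': "c' \<ge> b" "\<phi> c' = c" and d': "d' \<ge> b" "\<phi> d' = d"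
    using inv[of c] inv[of d] cd c by (auto simp: c'_def d'_def c_def d_def reverse_iterate_Suc)
  have lt: "c' < d'"
    using cd c' d' b strict_mono_on_less[OF mono, of c' d'] by auto
  have sub: "\<phi> x \<in> {c..d}" "x > T0" if "x \<in> {c'..d'}" for x
    using that c' d' b mono_onD[OF strict_mono_on_imp_mono_on[OF mono], of c' x]
      mono_onD[OF strict_mono_on_imp_mono_on[OF mono], of x d'] by auto
  \<comment> \<open>The innermost application is split off, as it is the one that leads into the
    interval of the induction hypothesis.\<close>
  have eq: "\<phi> ^^ Suc p = (\<lambda>x. (\<phi> ^^ p) (\<phi> x))"
    by (simp only: funpow_Suc_right) (simp add: fun_eq_iff)
  have "strict_mono_on {c'..d'} (\<phi> ^^ Suc p)"
  proof (rule strict_mono_onI)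
    fix x y assume xy: "x \<in> {c'..d'}" "y \<in> {c'..d'}" "x < y"
    then have "\<phi> x < \<phi> y"
      using sub by (intro strict_mono_onD[OF mono]) (auto intro: less_imp_le)
    then show "(\<phi> ^^ Suc p) x < (\<phi> ^^ Suc p) y"
      unfolding eq using IH sub xy strict_mono_onD[of "{c..d}" "\<phi> ^^ p" "\<phi> x" "\<phi> y"] by blast
  qed
  moreover have "(\<phi> ^^ Suc p) c' = S" "(\<phi> ^^ Suc p) d' = U"
    unfolding eq using IH c' d' by auto
  moreover have "((\<phi> ^^ Suc p) has_real_derivative (\<Prod>r<Suc p. deriv \<phi> ((\<phi> ^^ r) x))) (at x)"
    and "\<forall>r<Suc p. deriv \<phi> ((\<phi> ^^ r) x) \<ge> 0" if x: "x \<in> {c'..d'}" for x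
  proof -
    have shift: "(\<phi> ^^ Suc r) x = (\<phi> ^^ r) (\<phi> x)" for r by (simp add: funpow_swap1)
    have "((\<phi> ^^ p) has_real_derivative (\<Prod>r<p. deriv \<phi> ((\<phi> ^^ r) (\<phi> x)))) (at (\<phi> x))"
      using IH sub[OF x] by blast
    \<comment> \<open>The outer derivative is the product with indices shifted by one;
      \<open>deriv \<phi> x\<close> is the missing factor for index 0.\<close>
    from DERIV_chain2[OF this der[OF sub(2)[OF x]]]
    show "((\<phi> ^^ Suc p) has_real_derivative (\<Prod>r<Suc p. deriv \<phi> ((\<phi> ^^ r) x))) (at x)"
      unfolding eq prod.lessThan_Suc_shift shift by (simp add: mult.commute)
    have "deriv \<phi> ((\<phi> ^^ r) (\<phi> x)) \<ge> 0" if "r < p" for r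
      using IH sub[OF x] that by blast
    then show "\<forall>r<Suc p. deriv \<phi> ((\<phi> ^^ r) x) \<ge> 0"
      using nonneg[OF sub(2)[OF x]] by (auto simp: less_Suc_eq_0_disj shift simp del: funpow.simps(2))
  qed
  ultimately show ?case
    unfolding c'_def[symmetric] d'_def[symmetric] using lt by blast
qed

section \<open>Orthogonality of the transformed systems\<close>

text \<open>The argument of \<open>f n\<close> is an increasing bijection \<open>h\<close> of the
  interval onto itself with derivative \<open>s * q t\<close>, where \<open>s\<close> is the slope
  of the affine map; the product of the \<open>abs_Z_tilde\<close> is
  \<open>sqrt (q t)\<close>.\<close>

lemma L2_orthogonal_system_transformed_system:
  fixes \<phi> :: "real \<Rightarrow> real" and T0 T a l :: real and p :: nat
  assumes l: "l > 0" and f: "L2_orthogonal_system {a..a + 2 * l} f"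
  defines "c \<equiv> reverse_iterate T0 \<phi> p T" and "d \<equiv> reverse_iterate T0 \<phi> p (T + 2 * l)"
  assumes cd: "c < d" and mono: "strict_mono_on {c..d} (\<phi> ^^ p)"
    and ends: "(\<phi> ^^ p) c = T" "(\<phi> ^^ p) d = T + 2 * l"
    and der: "\<And>x. x \<in> {c..d} \<Longrightarrow>
      ((\<phi> ^^ p) has_real_derivative (\<Prod>r<p. deriv \<phi> ((\<phi> ^^ r) x))) (at x)"
    and nonneg: "\<And>x r. x \<in> {c..d} \<Longrightarrow> r < p \<Longrightarrow> deriv \<phi> ((\<phi> ^^ r) x) \<ge> 0"
  shows "L2_orthogonal_system {a..a + 2 * l} (transformed_system T0 \<phi> a l f p T)"
proof -
  define I where "I = {a..a + 2 * l}"
  define A where "A = ladder_affine T0 \<phi> a l p T"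
  define s where "s = (d - c) / (2 * l)"
  define h where "h = (\<lambda>t. (\<phi> ^^ p) (A t) - T + a)"
  define q where "q = (\<lambda>t. \<Prod>r<p. deriv \<phi> ((\<phi> ^^ r) (A t)))"
  have s: "s > 0" using cd l by (simp add: s_def)
  have A: "A t = s * (t - a) + c" for t
    by (simp add: A_def ladder_affine_def s_def c_def d_def)
  have A_mem: "A t \<in> {c..d}" if "t \<in> I" for t
  proof -
    have "s * (t - a) \<le> s * (2 * l)" using that s by (intro mult_left_mono) (auto simp: I_def)
    moreover have "s * (t - a) \<ge> 0" using that s by (auto simp: I_def)
    moreover have "s * (2 * l) = d - c" using l by (simp add: s_def)
    ultimately show ?thesis by (simp add: A)
  qed
  have h_der: "(h has_real_derivative s * q t) (at t within I)" if "t \<in> I" for t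
  proof -
    have "(A has_real_derivative s) (at t within I)"
      unfolding A by (auto intro!: derivative_eq_intros)
    from DERIV_chain2[OF der[OF A_mem[OF that]] this]
    show ?thesis
      unfolding h_def q_def by (auto intro!: derivative_eq_intros)
  qed
  have h_mono: "strict_mono_on I h"
  proof (rule strict_mono_onI)
    fix x y assume xy: "x \<in> I" "y \<in> I" "x < y"
    then have "A x < A y" using s by (simp add: A)
    then show "h x < h y"
      using strict_mono_onD[OF mono A_mem A_mem] xy by (simp add: h_def)
  qed
  have "continuous_on I h"
    using h_der by (meson DERIV_continuous continuous_on_eq_continuous_within)
  then have "h ` I = {h a..h (a + 2 * l)}"
    unfolding I_def using h_mono l by (intro strict_mono_on_Icc_image) (auto simp: I_def)
  \<comment> \<open>The affine map sends the endpoints to \<open>c\<close> and \<open>d\<close>, the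
    iterate sends these to \<open>T\<close> and \<open>T + 2 * l\<close>, and the shift by
    \<open>a - T\<close> returns to \<open>I\<close>.\<close>
  also have "\<dots> = I"
    using l by (simp add: h_def A ends I_def s_def)
  finally have image: "h ` I = I" .
  have q: "q t \<ge> 0" if "t \<in> I" for t
    unfolding q_def using nonneg[OF A_mem[OF that]] by (intro prod_nonneg) auto
  have "L2_orthogonal_system I (\<lambda>n t. f n (h t) * sqrt (q t))"
    by (rule L2_orthogonal_system_change_of_variables[where c = s])
       (use image h_der strict_mono_on_imp_inj_on[OF h_mono] s q f in \<open>auto simp: I_def\<close>)
  moreover have "sqrt (q t) = (\<Prod>r<p. abs_Z_tilde \<phi> ((\<phi> ^^ r) (A t)))" for t
  proof -
    \<comment> \<open>The real \<open>sqrt\<close> is an odd function and hence multiplicative on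
      all reals, so the root distributes for every \<open>t\<close>, also outside
      \<open>I\<close>.\<close>
    have "sqrt (\<Prod>r<n. g r) = (\<Prod>r<n. sqrt (g r))" for n and g :: "nat \<Rightarrow> real"
      by (induction n) (auto simp: real_sqrt_mult)
    then show ?thesis by (simp add: q_def abs_Z_tilde_def)
  qed
  ultimately show ?thesis
    by (simp add: transformed_system_def[abs_def] h_def A_def I_def)
qed

theorem theorem1:
  fixes \<alpha> T0 a l :: real and \<phi>1 :: "real \<Rightarrow> real" and f :: "nat \<Rightarrow> real \<Rightarrow> real" and k :: nat
  assumes "\<alpha> \<in> {7..8}"
    and "jacobs_ladder \<alpha> T0 \<phi>1"
    and "l > 0"
    and "L2_orthogonal_system {a..a + 2 * l} f"
    and "k \<ge> 1"
  shows "\<forall>\<^sub>F T in at_top. \<forall>p\<in>{1..k}.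
           L2_orthogonal_system {a..a + 2 * l} (transformed_system T0 \<phi>1 a l f p T)"
proof -
  have "\<alpha> > 0" using assms(1) by auto
  note ladder = jacobs_ladder_properties[OF this assms(2)]
  \<comment> \<open>Differentiability is known strictly beyond \<open>T0\<close>, so a closed ray
    starting to its right is fixed.\<close>
  define b where "b = T0 + 1"
  have b: "b > T0" by (simp add: b_def)
  have cont: "continuous_on {b..} \<phi>1"
    using b by (intro continuous_at_imp_continuous_on ballI DERIV_isCont[OF ladder(3)]) auto
  have "filterlim (reverse_iterate T0 \<phi>1 r) at_top at_top" for r
  proof (induction r)
    case 0
    then show ?case by (simp add: reverse_iterate_def[abs_def] filterlim_ident)
  next
    case (Suc r)
    then show ?case
      unfolding reverse_iterate_Suc[abs_def]
      by (rule filterlim_compose[OF filterlim_inv_into_at_top[OF ladder(1,2) cont less_imp_le[OF b]]])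
  qed
  \<comment> \<open>Only the finitely many indices \<open>r < k\<close> matter, so one threshold for
    \<open>T\<close> serves all \<open>p \<le> k\<close>.\<close>
  then have "\<forall>\<^sub>F T in at_top. \<forall>r\<in>{..<k}. reverse_iterate T0 \<phi>1 r T \<ge> \<phi>1 b"
    by (intro eventually_ball_finite) (auto simp: filterlim_at_top)
  then show ?thesis
  proof eventually_elim
    case (elim T)
    show ?case
    proof
      fix p assume p: "p \<in> {1..k}"
      have "reverse_iterate T0 \<phi>1 r T \<ge> \<phi>1 b" if "r < p" for r
        using elim p that by auto
      from iterate_on_reverse_interval[OF ladder b _ this, of "T + 2 * l"] \<open>l > 0\<close>
      show "L2_orthogonal_system {a..a + 2 * l} (transformed_system T0 \<phi>1 a l f p T)"
        by (intro L2_orthogonal_system_transformed_system assms) auto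
    qed
  qed
qed

end
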